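(* Let $N\ge 3$, let a regular $N$-gon (also denoted $N$) be given, centered at the origin, in standard orientation, let $\tau$ be the outer-billiards map of $N$, and let $1\le k<N/2$. Then the center $cS[k]$ of the tile $S[k]$ of $N$ has a well-defined $\tau$-orbit, which advances by $k$ vertices of $N$ on each iteration (i.e. if $c_j$ is the support vertex used in the $j$-th application of $\tau$, then $c_{j+1}$ is the vertex $k$ steps from $c_j$, always in the same rotational direction around $N$); consequently this orbit is periodic with period $N/\gcd(k,N)$.
   Context: Outer-billiards map: for a convex polygon and a point $p$ external to it, there are two support (tangent) lines through $p$; fix once and for all one of the two rotational conventions (clockwise or counterclockwise). If the support line chosen by the convention meets the polygon in a single vertex $c$, then $\tau(p)=2c-p$ (reflection of $p$ in $c$); if it contains an edge, $\tau(p)$ is undefined. A regular $m$-gon $P$ ($m\ge 3$) is in standard orientation if its lowest edge (the base edge) is horizontal. Write $cP$ for its center, $hP$ for its apothem, $sP$ for its side length, and $\mathrm{Mid}P=cP-(0,hP)$. For $1\le k<m/2$ the right-side and left-side star points $\mathrm{star}[k]$ of $P$ are $\mathrm{Mid}P\pm(hP\tan(k\pi/m),0)$. Tiles $S[k]$ of $N$ ($1\le k<N/2$): $S[k]$ is the regular polygon in standard orientation, with base edge on the base line of $N$, having $N$ sides if $N$ is even and $2N$ sides if $N$ is odd, whose center has $x$-coordinate equal to that of the left-side $\mathrm{star}[k]$ of $N$ minus $sN/2$, and whose right-side $\mathrm{star}[N/2-1]$ (if $N$ is even), respectively right-side $\mathrm{star}[N-2]$ (if $N$ is odd), is the left-side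 $\mathrm{star}[1]$ of $N$. *)

theory Defs
  imports "HOL-Analysis.Analysis"
begin

text \<open>The plane is identified with \<open>complex\<close>: the x-coordinate is \<open>Re\<close>, the y-coordinate is \<open>Im\<close>.\<close>

subsection \<open>Regular polygons\<close>

text \<open>A regular polygon with labelled vertices: the vertices are numbered counterclockwise by
  integers modulo the number of sides, and \<open>phase\<close> is the polar angle, seen from the center, of
  vertex number 0.  Neither \<open>0 < radius\<close> nor the orientation is built into the type.\<close>

record regpoly =
  sides :: nat
  center :: complex
  radius :: real
  phase :: real

definition regular_gon :: "nat \<Rightarrow> regpoly \<Rightarrow> bool" where
  "regular_gon m P \<longleftrightarrow> 3 \<le> m \<and> sides P = m \<and> 0 < radius P"

definition vertex :: "regpoly \<Rightarrow> int \<Rightarrow> complex" where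
  "vertex P j = center P
     + of_real (radius P) * cis (phase P + 2 * pi * real_of_int j / real (sides P))"

definition region :: "regpoly \<Rightarrow> complex set" where
  "region P = convex hull (range (vertex P))"

definition edge :: "regpoly \<Rightarrow> int \<Rightarrow> complex set" where
  "edge P j = closed_segment (vertex P j) (vertex P (j + 1))"

definition side_length :: "regpoly \<Rightarrow> real" where
  "side_length P = dist (vertex P 0) (vertex P 1)"

definition apothem :: "regpoly \<Rightarrow> real" where
  "apothem P = dist (center P) (midpoint (vertex P 0) (vertex P 1))"

definition is_base_edge :: "regpoly \<Rightarrow> int \<Rightarrow> bool" where
  "is_base_edge P j \<longleftrightarrow>
     Im (vertex P j) = Im (vertex P (j + 1)) \<and> (\<forall>i. Im (vertex P j) \<le> Im (vertex P i))"

definition standard_orientation :: "regpoly \<Rightarrow> bool" where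
  "standard_orientation P \<longleftrightarrow> (\<exists>j. is_base_edge P j)"

definition base_line :: "regpoly \<Rightarrow> complex set" where
  "base_line P = {z. \<exists>j. is_base_edge P j \<and> Im z = Im (vertex P j)}"

definition Mid :: "regpoly \<Rightarrow> complex" where
  "Mid P = center P - Complex 0 (apothem P)"

definition right_star :: "regpoly \<Rightarrow> nat \<Rightarrow> complex" where
  "right_star P k = Mid P + Complex (apothem P * tan (real k * pi / real (sides P))) 0"

definition left_star :: "regpoly \<Rightarrow> nat \<Rightarrow> complex" where
  "left_star P k = Mid P - Complex (apothem P * tan (real k * pi / real (sides P))) 0"

text \<open>\<open>is_tile P k S\<close>: \<open>S\<close> is the tile \<open>S[k]\<close> of \<open>P\<close>.  These conditions determine \<open>S\<close> up to the
  numbering of its vertices; existence is lemma \<open>is_tile_exists\<close> below.\<close>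

definition is_tile :: "regpoly \<Rightarrow> nat \<Rightarrow> regpoly \<Rightarrow> bool" where
  "is_tile P k S \<longleftrightarrow>
     regular_gon (if even (sides P) then sides P else 2 * sides P) S \<and>
     standard_orientation S \<and>
     (\<exists>j. is_base_edge S j \<and> edge S j \<subseteq> base_line P) \<and>
     Re (center S) = Re (left_star P k) - side_length P / 2 \<and>
     right_star S (if even (sides P) then sides P div 2 - 1 else sides P - 2) = left_star P 1"

subsection \<open>Outer billiards\<close>

datatype rotation = Clockwise | Counterclockwise

fun orientation :: "rotation \<Rightarrow> real" where
  "orientation Counterclockwise = 1"
| "orientation Clockwise = - 1"

text \<open>The support line of \<open>A\<close> through \<open>p\<close> selected by the convention \<open>d\<close>.  The line is directed by
  \<open>u\<close> so that it runs from \<open>p\<close> towards \<open>A\<close>; then \<open>A\<close> lies to its left for \<open>Counterclockwise\<close> and to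
  its right for \<open>Clockwise\<close>.  Here \<open>Im (cnj u * w)\<close> is the cross product of \<open>u\<close> and \<open>w\<close>.\<close>

definition support_line :: "rotation \<Rightarrow> complex set \<Rightarrow> complex \<Rightarrow> complex set \<Rightarrow> bool" where
  "support_line d A p L \<longleftrightarrow>
     (\<exists>u. u \<noteq> 0 \<and> L = range (\<lambda>t::real. p + of_real t * u) \<and>
          (\<exists>t\<ge>0. p + of_real t * u \<in> A) \<and>
          (\<forall>z\<in>A. 0 \<le> orientation d * Im (cnj u * (z - p))))"

text \<open>A support line that meets a polygon in exactly one point meets it in a vertex.\<close>

definition support_vertex :: "rotation \<Rightarrow> complex set \<Rightarrow> complex \<Rightarrow> complex \<Rightarrow> bool" where
  "support_vertex d A p c \<longleftrightarrow> p \<notin> A \<and> (\<exists>L. support_line d A p L \<and> L \<inter> A = {c})"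

text \<open>\<open>None\<close> means that the outer-billiards map is undefined at \<open>p\<close>.\<close>

definition outer_billiards :: "rotation \<Rightarrow> complex set \<Rightarrow> complex \<Rightarrow> complex option" where
  "outer_billiards d A p =
     (if \<exists>c. support_vertex d A p c then Some (2 * (THE c. support_vertex d A p c) - p) else None)"

fun iterate :: "('a \<Rightarrow> 'a option) \<Rightarrow> nat \<Rightarrow> 'a \<Rightarrow> 'a option" where
  "iterate T 0 x = Some x"
| "iterate T (Suc n) x = Option.bind (iterate T n x) T"

text \<open>The period is the least one.\<close>

definition has_period :: "('a \<Rightarrow> 'a option) \<Rightarrow> 'a \<Rightarrow> nat \<Rightarrow> bool" where
  "has_period T x n \<longleftrightarrow>
     0 < n \<and> iterate T n x = Some x \<and> (\<forall>m. 0 < m \<and> m < n \<longrightarrow> iterate T m x \<noteq> Some x)"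

subsection \<open>Existence of the tiles\<close>

lemma Im_vertex:
  "Im (vertex P j) = Im (center P) + radius P * sin (phase P + 2 * pi * real_of_int j / real (sides P))"
  by (simp add: vertex_def)

lemma midpoint_vertex:
  "midpoint (vertex P 0) (vertex P 1) = center P
     + of_real (radius P * cos (pi / real (sides P))) * cis (phase P + pi / real (sides P))"
proof -
  define b where "b = pi / real (sides P)"
  have "vertex P 0 = center P + of_real (radius P) * (cis (phase P + b) * cis (- b))"
    by (simp add: vertex_def cis_mult)
  moreover have "vertex P 1 = center P + of_real (radius P) * (cis (phase P + b) * cis b)"
    by (simp add: vertex_def cis_mult b_def add.commute)
  ultimately show ?thesis
    unfolding b_def[symmetric]
    by (simp add: complex_eq_iff midpoint_def algebra_simps)
qed

lemma apothem_eq: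
  assumes "regular_gon m P"
  shows "apothem P = radius P * cos (pi / real m)" and "0 < apothem P"
proof -
  have m: "3 \<le> m" "sides P = m" "0 < radius P"
    using assms by (auto simp: regular_gon_def)
  have "0 < cos (pi / real m)"
    using m by (intro cos_gt_zero) (auto simp: field_simps)
  then show "apothem P = radius P * cos (pi / real m)" "0 < apothem P"
    using m by (auto simp: apothem_def midpoint_vertex dist_norm norm_mult)
qed

lemma Im_base_edge:
  assumes "regular_gon m P" and "is_base_edge P j"
  shows "Im (vertex P j) = Im (Mid P)"
proof -
  define b where "b = pi / real m"
  define \<mu> where "\<mu> = phase P + 2 * pi * real_of_int j / real m + b"
  have m: "3 \<le> m" "sides P = m" "0 < radius P"
    using assms by (auto simp: regular_gon_def)
  have b: "0 < b" "3 * b \<le> pi"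
    using m by (auto simp: b_def field_simps)
  have v0: "Im (vertex P j) = Im (center P) + radius P * sin (\<mu> - b)"
    by (simp add: Im_vertex m \<mu>_def)
  have v1: "Im (vertex P (j + 1)) = Im (center P) + radius P * sin (\<mu> + b)"
    by (simp add: Im_vertex m \<mu>_def b_def add_divide_distrib algebra_simps)
  have v2: "Im (vertex P (j - 1)) = Im (center P) + radius P * sin (\<mu> - 3 * b)"
    by (simp add: Im_vertex m \<mu>_def b_def diff_divide_distrib algebra_simps)
  have "sin (\<mu> - b) = sin (\<mu> + b)"
    using assms(2) m v0 v1 by (simp add: is_base_edge_def)
  moreover have "0 < sin b"
    using b by (intro sin_gt_zero) auto
  ultimately have c: "cos \<mu> = 0"
    by (simp add: sin_add sin_diff)
  have lt: "cos (3 * b) < cos b"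
    using b by (intro cos_monotone_0_pi) auto
  have "radius P * sin (\<mu> - b) \<le> radius P * sin (\<mu> - 3 * b)"
    using assms(2) v0 v2 by (auto simp: is_base_edge_def dest: spec[of _ "j - 1"])
  then have "sin \<mu> * cos b \<le> sin \<mu> * cos (3 * b)"
    using m c by (simp add: sin_diff)
  with lt have "sin \<mu> \<le> 0"
    by (metis less_eq_real_def linorder_not_less mult_less_cancel_left_pos)
  moreover have "(sin \<mu>)\<^sup>2 = 1"
    using c sin_cos_squared_add[of \<mu>] by simp
  ultimately have "sin \<mu> = - 1"
    by (auto simp: power2_eq_1_iff)
  then show ?thesis
    using v0 c by (simp add: sin_diff Mid_def apothem_eq[OF assms(1)] b_def)
qed

lemma cos_odd_multiple_le:
  assumes "1 \<le> m"
  shows "cos ((2 * real_of_int i - 1) * pi / real m) \<le> cos (pi / real m)"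
proof -
  define r where "r = i mod int m"
  define a where "a = (2 * real_of_int r - 1) * pi / real m"
  define b where "b = pi / real m"
  have r: "0 \<le> r" "r < int m"
    using assms by (auto simp: r_def)
  have "i = r + int m * (i div int m)"
    by (simp add: r_def)
  then have "real_of_int i = real_of_int r + real m * real_of_int (i div int m)"
    by (metis of_int_add of_int_mult of_int_of_nat_eq)
  then have "(2 * real_of_int i - 1) * pi / real m = a + 2 * pi * real_of_int (i div int m)"
    using assms by (simp add: a_def field_simps)
  then have "cos ((2 * real_of_int i - 1) * pi / real m) = cos a"
    by (simp only: cos_add cos_int_2pin sin_int_2pin)
  also have "cos a \<le> cos b"
  proof (cases "r = 0")
    case True
    then show ?thesis by (simp add: a_def b_def)
  next
    case False
    have "1 \<le> real_of_int r" using r False by linarith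
    then have 1: "b \<le> a"
      unfolding a_def b_def using assms by (intro divide_right_mono) auto
    have "real_of_int r \<le> real m - 1" using r by linarith
    then have "(2 * real_of_int r - 1) * pi \<le> (2 * real m - 1) * pi"
      by (intro mult_right_mono) auto
    then have 2: "a \<le> 2 * pi - b"
      unfolding a_def b_def using assms by (simp add: field_simps)
    have b: "0 \<le> b" by (simp add: b_def)
    show ?thesis
    proof (cases "a \<le> pi")
      case True
      then show ?thesis using 1 b by (intro cos_monotone_0_pi_le) auto
    next
      case False
      have "cos (2 * pi - a) \<le> cos b"
        using 2 b False by (intro cos_monotone_0_pi_le) auto
      then show ?thesis by simp
    qed
  qed
  finally show ?thesis by (simp add: b_def)
qed

lemma is_tile_exists:
  assumes P: "regular_gon N P" "standard_orientation P" and k: "1 \<le> k" "2 * k < N"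
  shows "\<exists>S. is_tile P k S"
proof -
  have N: "3 \<le> N" "sides P = N" "0 < radius P"
    using P by (auto simp: regular_gon_def)
  define M where "M = (if even N then N else 2 * N)"
  define h where "h = apothem P * tan (real k * pi / real N) * tan (pi / real N)"
  define x where "x = Re (left_star P k) - side_length P / 2"
  define y where "y = Im (Mid P) + h"
  define S where "S = \<lparr>sides = M, center = Complex x y, radius = h / cos (pi / real M),
                       phase = - (pi / 2) - pi / real M\<rparr>"
  have M: "3 \<le> M" using N by (simp add: M_def)
  have cM: "0 < cos (pi / real M)"
    using M by (intro cos_gt_zero) (auto simp: field_simps)
  have cN: "0 < cos (pi / real N)"
    using N by (intro cos_gt_zero) (auto simp: field_simps)
  have tN: "0 < tan (pi / real N)"
    using N by (intro tan_gt_zero) (auto simp: field_simps)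
  have "real (2 * k) < real N" using k by (simp only: of_nat_less_iff)
  then have tk: "0 < tan (real k * pi / real N)"
    using k N by (intro tan_gt_zero) (auto simp: field_simps)
  have hpos: "0 < h"
    using tN tk apothem_eq(2)[OF P(1)] by (simp add: h_def)
  have rS: "regular_gon M S"
    using M hpos cM by (simp add: regular_gon_def S_def)
  have hS: "apothem S = h"
    using apothem_eq(1)[OF rS] cM by (simp add: S_def)
  have side: "side_length P = 2 * apothem P * tan (pi / real N)"
  proof -
    define b where "b = pi / real N"
    define m where "m = cis (phase P + b)"
    have v0: "vertex P 0 = center P + of_real (radius P) * (m * cis (- b))"
      by (simp add: vertex_def cis_mult m_def)
    have v1: "vertex P 1 = center P + of_real (radius P) * (m * cis b)"
      by (simp add: vertex_def cis_mult m_def b_def N add.commute)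
    have "vertex P 0 - vertex P 1 = of_real (radius P) * m * (cis (- b) - cis b)"
      unfolding v0 v1 by (simp add: algebra_simps)
    also have "cis (- b) - cis b = of_real (- 2 * sin b) * \<i>"
      by (simp add: complex_eq_iff)
    finally have "side_length P = radius P * (2 * \<bar>sin b\<bar>)"
      using N by (simp add: side_length_def dist_norm norm_mult m_def)
    moreover have "0 < sin b"
      using N by (intro sin_gt_zero) (auto simp: b_def field_simps)
    ultimately show ?thesis
      using cN by (simp add: apothem_eq(1)[OF P(1)] tan_def b_def)
  qed
  have base: "is_base_edge S 0"
    unfolding is_base_edge_def
  proof (intro conjI allI)
    have a: "radius S > 0" using rS by (simp add: regular_gon_def)
    have *: "Im (vertex S i) = y - radius S * cos ((2 * real_of_int i - 1) * pi / real M)" for i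
    proof -
      have "phase S + 2 * pi * real_of_int i / real (sides S)
              = (2 * real_of_int i - 1) * pi / real M - pi / 2"
        by (simp add: S_def diff_divide_distrib algebra_simps)
      then have "Im (vertex S i) = y + radius S * sin ((2 * real_of_int i - 1) * pi / real M - pi / 2)"
        by (simp only: Im_vertex) (simp add: S_def)
      then show ?thesis by (simp add: sin_diff)
    qed
    show "Im (vertex S 0) = Im (vertex S (0 + 1))"
      unfolding * by simp
    show "Im (vertex S 0) \<le> Im (vertex S i)" for i
      unfolding * using a cos_odd_multiple_le[of M i] M by simp
  qed
  have lev: "Im (Mid S) = Im (Mid P)"
    by (simp add: Mid_def hS) (simp add: S_def y_def Mid_def)
  obtain j where j: "is_base_edge P j"
    using P(2) by (auto simp: standard_orientation_def)
  have imS: "Im (vertex S 0) = Im (vertex P j)" "Im (vertex S 1) = Im (vertex P j)"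
    using Im_base_edge[OF P(1) j] Im_base_edge[OF rS base] lev base
    by (auto simp: is_base_edge_def)
  have "edge S 0 \<subseteq> base_line P"
  proof
    fix z assume "z \<in> edge S 0"
    then obtain u where "z = (1 - u) *\<^sub>R vertex S 0 + u *\<^sub>R vertex S 1"
      by (auto simp: edge_def in_segment)
    then have "Im z = (1 - u) * Im (vertex S 0) + u * Im (vertex S 1)"
      by simp
    then have "Im z = Im (vertex P j)"
      unfolding imS by (simp add: algebra_simps)
    then show "z \<in> base_line P"
      using j by (auto simp: base_line_def)
  qed
  moreover have "right_star S (if even N then N div 2 - 1 else N - 2) = left_star P 1"
  proof -
    define l where "l = (if even N then N div 2 - 1 else N - 2)"
    have "real l * pi / real M = pi / 2 - pi / real N"
    proof (cases "even N")
      case True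
      then obtain n where n: "N = 2 * n" by auto
      then show ?thesis using N
        by (simp add: l_def M_def of_nat_diff field_simps)
    next
      case False
      then show ?thesis using N
        by (simp add: l_def M_def of_nat_diff field_simps)
    qed
    then have "tan (real l * pi / real M) = 1 / tan (pi / real N)"
      by (simp add: tan_def sin_diff cos_diff)
    then have "h * tan (real l * pi / real M) = apothem P * tan (real k * pi / real N)"
      using tN by (simp add: h_def)
    moreover have "sides S = M" "Re (center S) = x" by (simp_all add: S_def)
    ultimately have "right_star S l = left_star P 1"
      using lev
      by (simp add: right_star_def left_star_def complex_eq_iff hS N)
         (simp add: Mid_def x_def left_star_def side N)
    then show ?thesis by (simp add: l_def)
  qed
  ultimately have "is_tile P k S"
    unfolding is_tile_def standard_orientation_def
    using rS base by (auto simp: N M_def S_def x_def)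
  then show ?thesis ..
qed

end

theory Submission imports Defs begin

text \<open>Put \<open>\<theta> = k\<pi>/N\<close> and \<open>t = tan \<theta>\<close>.  If \<open>v\<close> is the left end of the base edge, the center of
  \<open>S[k]\<close> is \<open>v(1 - \<i>t)\<close>, so it lies on the tangent at \<open>v\<close> of the circumscribed circle, and this
  tangent meets the polygon only in \<open>v\<close>.  Reflection in \<open>v\<close> gives
  \<open>v(1 + \<i>t) = v(1 - \<i>t) cis(2\<theta>)\<close>, the image under the rotation that advances the vertices by \<open>k\<close>.
  The other convention yields the inverse rotation, starting from the vertex \<open>v cis(-2\<theta>)\<close>.\<close>

section \<open>Uniqueness of the support vertex\<close>

text \<open>Each of \<open>c\<close> and \<open>c'\<close> lies on the prescribed side of the
  other's support line, so the cross product of \<open>c - p\<close> and \<open>c' - p\<close> has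
  both signs and vanishes. Hence \<open>c'\<close> is on the line through \<open>p\<close> and
  \<open>c\<close>, which meets \<open>A\<close> only in \<open>c\<close>.\<close>

lemma support_vertex_unique:
  assumes "support_vertex d A p c" and "support_vertex d A p c'"
  shows "c = c'"
proof -
  \<comment> \<open>The vector \<open>c - p\<close> is a nonnegative multiple of the hidden
    direction \<open>u\<close> and can replace it, so that the support line is described by
    \<open>p\<close> and \<open>c\<close> alone.\<close>
  have *: "c \<in> A \<and> c \<noteq> p \<and> (\<forall>z\<in>A. 0 \<le> orientation d * Im (cnj (c - p) * (z - p))) \<and>
      (\<forall>z\<in>A. (\<exists>r::real. z = p + of_real r * (c - p)) \<longrightarrow> z = c)"
    if c: "support_vertex d A p c" for c
  proof -
    obtain u where pA: "p \<notin> A" and A: "range (\<lambda>t::real. p + of_real t * u) \<inter> A = {c}"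
      and ex: "\<exists>t\<ge>0. p + of_real t * u \<in> A"
      and pos: "\<forall>z\<in>A. 0 \<le> orientation d * Im (cnj u * (z - p))"
      using c unfolding support_vertex_def support_line_def by blast
    obtain t where t: "t \<ge> 0" "p + of_real t * u \<in> A" using ex by blast
    then have "p + of_real t * u \<in> range (\<lambda>t::real. p + of_real t * u) \<inter> A" by blast
    then have ct: "c = p + of_real t * u" using A by simp
    have "0 \<le> orientation d * Im (cnj (c - p) * (z - p))" if "z \<in> A" for z
    proof -
      have "orientation d * Im (cnj (c - p) * (z - p)) = t * (orientation d * Im (cnj u * (z - p)))"
        by (simp add: ct algebra_simps)
      then show ?thesis using bspec[OF pos that] t(1) by (simp only: mult_nonneg_nonneg)
    qed
    moreover have "z = c" if "z \<in> A" "z = p + of_real r * (c - p)" for z and r :: real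
    proof -
      have "z = p + of_real (r * t) * u" using that by (simp add: ct)
      then show ?thesis using A that by blast
    qed
    moreover have "c \<in> A" "c \<noteq> p" using t(2) pA ct by auto
    ultimately show ?thesis by blast
  qed
  define w where "w = (c' - p) * cnj (c - p)"
  note c = *[OF assms(1)] and c' = *[OF assms(2)]
  have "0 \<le> orientation d * Im (cnj (c - p) * (c' - p))"
    "0 \<le> orientation d * Im (cnj (c' - p) * (c - p))"
    using c c' by blast+
  moreover have "Im (cnj (c - p) * (c' - p)) = Im w" "Im (cnj (c' - p) * (c - p)) = - Im w"
    by (simp_all add: w_def algebra_simps)
  ultimately have "0 \<le> orientation d * Im w" "0 \<le> orientation d * - Im w" by simp_all
  then have "Im w = 0" by (cases d) auto
  then have w: "w = of_real (Re w)" by (simp add: complex_eq_iff)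
  \<comment> \<open>Since \<open>w\<close> is real and \<open>q\<close> is the squared length of
    \<open>c - p\<close>, the quotient \<open>w / q\<close> is the real parameter of
    \<open>c'\<close> on the line from \<open>p\<close> through \<open>c\<close>.\<close>
  define q where "q = (c - p) * cnj (c - p)"
  have q: "q = of_real ((cmod (c - p))\<^sup>2)" unfolding q_def by (rule complex_norm_square[symmetric])
  have "c' = p + w / q * (c - p)"
    using c by (simp add: w_def q_def)
  also have "w / q = of_real (Re w / (cmod (c - p))\<^sup>2)"
    unfolding q of_real_divide by (subst w) (rule refl)
  finally have "\<exists>r::real. c' = p + of_real r * (c - p)" by (rule exI)
  moreover have "c' \<in> A" using c' by (rule conjunct1)
  ultimately show ?thesis using c by metis
qed

lemma outer_billiards_eq:
  assumes "support_vertex d A p c"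
  shows "outer_billiards d A p = Some (2 * c - p)"
proof -
  have "(THE c. support_vertex d A p c) = c"
    using assms support_vertex_unique by blast
  then show ?thesis using assms by (auto simp: outer_billiards_def)
qed

section \<open>Vertices of a centered polygon and tangents of its circumscribed circle\<close>

lemma norm_vertex:
  assumes "regular_gon N P" and "center P = 0"
  shows "norm (vertex P i) = radius P"
  using assms by (simp add: vertex_def norm_mult regular_gon_def)

text \<open>Lets the disc stand in for the polygon in the tangent argument, so that no inequality
  about individual edges is needed.\<close>

lemma region_subset_cball:
  assumes "regular_gon N P" and "center P = 0"
  shows "region P \<subseteq> cball 0 (radius P)"
  unfolding region_def by (rule hull_minimal) (auto simp: norm_vertex[OF assms])

lemma vertex_add:
  assumes "center P = 0"
  shows "vertex P (i + m) = vertex P i * cis (2 * pi * real_of_int m / real (sides P))"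
  using assms by (simp add: vertex_def cis_mult algebra_simps add_divide_distrib)

text \<open>Turns the return of the orbit into arithmetic: the rotation relating the two vertices is
  trivial only for a whole number of turns.\<close>

lemma vertex_add_eq_iff:
  assumes "regular_gon N P" and "center P = 0"
  shows "vertex P (i + m) = vertex P i \<longleftrightarrow> int N dvd m"
proof -
  have N: "0 < N" "sides P = N" "vertex P i \<noteq> 0"
    using assms norm_vertex[OF assms, of i] by (auto simp: regular_gon_def)
  have "vertex P (i + m) = vertex P i \<longleftrightarrow> cis (2 * pi * real_of_int m / real N) = 1"
    using N by (simp add: vertex_add[OF assms(2)])
  also have "\<dots> \<longleftrightarrow> (\<exists>n::int. 2 * pi * real_of_int m / real N = of_int (2 * n) * pi)"
    by (simp add: cis_conv_exp exp_eq_1)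
  also have "\<dots> \<longleftrightarrow> (\<exists>n::int. m = int N * n)"
  proof -
    have "2 * pi * real_of_int m / real N = of_int (2 * n) * pi \<longleftrightarrow> real_of_int m = real_of_int (int N * n)" for n
      using N by (auto simp: field_simps)
    then show ?thesis by (simp only: of_int_eq_iff)
  qed
  finally show ?thesis by (simp add: dvd_def)
qed

text \<open>The disc lies on one side of the tangent at \<open>vertex P i\<close>. The factor
  \<open>orientation d\<close> puts the point on that half of the tangent from which, looking
  towards the vertex, this is the side demanded by \<open>d\<close>.\<close>

lemma support_vertex_tangent:
  assumes P: "regular_gon N P" "center P = 0" and t: "0 < t"
  shows "support_vertex d (region P) (vertex P i * Complex 1 (- orientation d * t)) (vertex P i)"
proof -
  define \<sigma> where "\<sigma> = orientation d"
  define c where "c = vertex P i"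
  define p where "p = c * Complex 1 (- \<sigma> * t)"
  define u where "u = \<i> * of_real \<sigma> * c"
  have \<sigma>: "\<sigma> * \<sigma> = 1" by (cases d) (auto simp: \<sigma>_def)
  have R: "0 < radius P" using P by (simp add: regular_gon_def)
  have nc: "norm c = radius P" using norm_vertex[OF P] by (simp add: c_def)
  have c: "c \<in> region P" unfolding region_def c_def by (auto intro: hull_inc)
  have line: "p + of_real r * u = c + of_real ((r - t) * \<sigma>) * (\<i> * c)" for r
    by (simp add: p_def u_def complex_eq_iff algebra_simps)
  have cross: "\<sigma> * Im (cnj u * (z - p)) = (norm c)\<^sup>2 - Re (cnj c * z)" for z
  proof -
    have "\<sigma> * Im (cnj u * (z - p)) = (\<sigma> * \<sigma>) * ((norm c)\<^sup>2 - Re (cnj c * z))"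
      unfolding cmod_power2 by (simp add: p_def u_def algebra_simps power2_eq_square)
    then show ?thesis using \<sigma> by simp
  qed
  \<comment> \<open>With \<open>norm z \<le> norm c\<close> on the region, this bounds the inner
    product \<open>Re (cnj c * z)\<close> by \<open>(norm c)\<^sup>2\<close>, with equality only at
    \<open>z = c\<close>. The bound is the support condition, the equality case the single contact
    point.\<close>
  have norm_diff: "(norm (z - c))\<^sup>2 = (norm z)\<^sup>2 - 2 * Re (cnj c * z) + (norm c)\<^sup>2" for z
    unfolding cmod_power2 by (simp add: power2_eq_square algebra_simps)
  have nz: "(norm z)\<^sup>2 \<le> (norm c)\<^sup>2" if "z \<in> region P" for z
    using region_subset_cball[OF P] that nc by (auto intro!: power_mono)
  have touch: "z = c" if "z \<in> region P" "Re (cnj c * z) = (norm c)\<^sup>2" for z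
  proof -
    have "(norm (z - c))\<^sup>2 \<le> 0" using norm_diff[of z] nz[OF that(1)] that(2) by linarith
    then show ?thesis by simp
  qed
  have on_line: "Re (cnj c * (p + of_real r * u)) = (norm c)\<^sup>2" for r
    unfolding line cmod_power2 by (simp add: power2_eq_square algebra_simps)
  have "p \<noteq> c"
  proof
    assume "p = c"
    then have "Complex 1 (- \<sigma> * t) = 1" using nc R by (auto simp: p_def)
    then show False using \<sigma> t by (auto simp: complex_eq_iff)
  qed
  moreover have "Re (cnj c * p) = (norm c)\<^sup>2" using on_line[of 0] by simp
  ultimately have pA: "p \<notin> region P" using touch by blast
  have contact: "p + of_real t * u = c" unfolding line by simp
  have "support_line d (region P) p (range (\<lambda>r::real. p + of_real r * u))"
    unfolding support_line_def
  proof (intro exI[of _ u] conjI refl ballI)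
    show "u \<noteq> 0" using nc R \<sigma> by (auto simp: u_def)
    show "\<exists>t\<ge>0. p + of_real t * u \<in> region P" using contact c t by (intro exI[of _ t]) auto
    fix z assume "z \<in> region P"
    then show "0 \<le> orientation d * Im (cnj u * (z - p))"
      using cross[of z] norm_diff[of z] nz[of z] zero_le_power2[of "norm (z - c)"] unfolding \<sigma>_def by linarith
  qed
  moreover have "range (\<lambda>r::real. p + of_real r * u) \<inter> region P = {c}"
  proof -
    have "c \<in> range (\<lambda>r::real. p + of_real r * u)" using contact by (metis rangeI)
    then show ?thesis using touch[OF _ on_line] c by blast
  qed
  ultimately show ?thesis
    using pA unfolding support_vertex_def p_def c_def \<sigma>_def by blast
qed

section \<open>Position of the tile center\<close>

text \<open>The apothem fixes the height; equality with the height at the angle \<open>2 * b\<close>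
  further on then fixes the sign of the cosine. Counterclockwise numbering thus makes
  \<open>j\<close> the left end of the base edge.\<close>

lemma vertex_base_edge:
  assumes P: "regular_gon N P" "center P = 0" and j: "is_base_edge P j"
  shows "vertex P j = of_real (radius P) * Complex (- sin (pi / N)) (- cos (pi / N))"
proof -
  define b where "b = pi / real N"
  define \<alpha> where "\<alpha> = phase P + 2 * pi * real_of_int j / real N"
  have N: "3 \<le> N" "sides P = N" "0 < radius P" using P by (auto simp: regular_gon_def)
  have sb: "0 < sin b"
    using N by (intro sin_gt_zero) (auto simp: b_def field_simps)
  have cb: "0 < cos b"
    using N by (intro cos_gt_zero) (auto simp: b_def field_simps)
  have v: "vertex P j = of_real (radius P) * cis \<alpha>"
    by (simp add: vertex_def N P \<alpha>_def)
  have "vertex P (j + 1) = of_real (radius P) * cis (\<alpha> + 2 * b)"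
    by (simp add: vertex_def N P \<alpha>_def b_def algebra_simps add_divide_distrib)
  then have 1: "sin (\<alpha> + 2 * b) = sin \<alpha>"
    using j v N by (simp add: is_base_edge_def)
  have "radius P * sin \<alpha> = radius P * (- cos b)"
    using Im_base_edge[OF P(1) j] v by (simp add: Mid_def P apothem_eq[OF P(1)] b_def)
  then have 2: "sin \<alpha> = - cos b"
    using N by (simp only: mult_cancel_left) simp
  have "sin \<alpha> * (1 - 2 * (sin b)\<^sup>2) + cos \<alpha> * (2 * sin b * cos b) = sin \<alpha>"
    using 1 by (simp add: sin_add cos_double_sin sin_double)
  then have "2 * sin b * cos b * (cos \<alpha> + sin b) = 0"
    unfolding 2 by (simp add: algebra_simps power2_eq_square)
  then have "cos \<alpha> = - sin b" using sb cb by simp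
  then show ?thesis using 2 by (simp add: v complex_eq_iff b_def)
qed

lemma side_length_eq:
  assumes P: "regular_gon N P"
  shows "side_length P = 2 * radius P * sin (pi / N)"
proof -
  define b where "b = pi / real N"
  have N: "3 \<le> N" "sides P = N" "0 < radius P" using P by (auto simp: regular_gon_def)
  \<comment> \<open>The direction of the edge midpoint: the two ends lie symmetrically about it, at
    angles \<open>- b\<close> and \<open>b\<close>.\<close>
  define m where "m = cis (phase P + b)"
  have v0: "vertex P 0 = center P + of_real (radius P) * (m * cis (- b))"
    by (simp add: vertex_def cis_mult m_def)
  have v1: "vertex P 1 = center P + of_real (radius P) * (m * cis b)"
    by (simp add: vertex_def cis_mult m_def b_def N add.commute)
  have "vertex P 0 - vertex P 1 = of_real (radius P) * m * (cis (- b) - cis b)"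
    unfolding v0 v1 by (simp add: algebra_simps)
  also have "cis (- b) - cis b = of_real (- 2 * sin b) * \<i>"
    by (simp add: complex_eq_iff)
  finally have "side_length P = radius P * (2 * \<bar>sin b\<bar>)"
    using N by (simp add: side_length_def dist_norm norm_mult m_def)
  moreover have "0 < sin b"
    using N by (intro sin_gt_zero) (auto simp: b_def field_simps)
  ultimately show ?thesis by (simp add: b_def)
qed

text \<open>The abscissa is prescribed. The common base line expresses the ordinate by
  \<open>apothem S\<close>, and the matching star points determine that apothem.\<close>

lemma tile_center:
  assumes P: "regular_gon N P" "center P = 0" and j: "is_base_edge P j" and S: "is_tile P k S"
  shows "center S = vertex P j * Complex 1 (- tan (real k * pi / N))"
proof -
  define b where "b = pi / real N"
  define h where "h = apothem P"
  define \<tau> where "\<tau> = tan (real k * pi / N)"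
  define M where "M = (if even N then N else 2 * N)"
  define l where "l = (if even N then N div 2 - 1 else N - 2)"
  have N: "3 \<le> N" "sides P = N" "0 < radius P" using P by (auto simp: regular_gon_def)
  have sb: "0 < sin b"
    using N by (intro sin_gt_zero) (auto simp: b_def field_simps)
  have cb: "0 < cos b"
    using N by (intro cos_gt_zero) (auto simp: b_def field_simps)
  have h: "h = radius P * cos b" using apothem_eq(1)[OF P(1)] by (simp add: h_def b_def)
  have rS: "regular_gon M S" and ReS: "Re (center S) = Re (left_star P k) - side_length P / 2"
    and star: "right_star S l = left_star P 1"
    using S by (simp_all add: is_tile_def N M_def l_def split: if_splits)
  have sM: "sides S = M" using rS by (simp add: regular_gon_def)
  obtain i where i: "is_base_edge S i" and sub: "edge S i \<subseteq> base_line P"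
    using S by (auto simp: is_tile_def)
  have "vertex S i \<in> base_line P" using sub by (auto simp: edge_def)
  then have "Im (vertex S i) = Im (Mid P)"
    using Im_base_edge[OF P(1)] by (auto simp: base_line_def)
  then have ImS: "Im (center S) = apothem S - h"
    using Im_base_edge[OF rS i] by (simp add: Mid_def P h_def)
  \<comment> \<open>The star index is chosen by parity so that its angle is complementary to
    \<open>b\<close>, which makes its tangent the cotangent of \<open>b\<close>.\<close>
  have "real l * pi / real M = pi / 2 - b"
  proof (cases "even N")
    case True
    then obtain n where n: "N = 2 * n" by auto
    then show ?thesis using N
      by (simp add: l_def M_def b_def of_nat_diff field_simps)
  next
    case False
    then show ?thesis using N
      by (simp add: l_def M_def b_def of_nat_diff field_simps)
  qed
  then have cot: "tan (real l * pi / real M) = cos b / sin b"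
    by (simp add: tan_def sin_diff cos_diff)
  have Re: "Re (center S) = - (h * \<tau>) - radius P * sin b"
    using ReS by (simp add: left_star_def Mid_def P N side_length_eq[OF P(1)] h_def \<tau>_def b_def)
  have "Re (center S) + apothem S * (cos b / sin b) = - (h * tan b)"
    using arg_cong[OF star, of Re]
    by (simp add: right_star_def left_star_def Mid_def P N sM cot h_def b_def)
  \<comment> \<open>Half the side length of \<open>P\<close> and \<open>h * tan b\<close> both equal
    \<open>radius P * sin b\<close> and cancel.\<close>
  then have "apothem S * (cos b / sin b) = h * \<tau>"
    using Re cb by (simp add: h tan_def)
  then have "apothem S = radius P * sin b * \<tau>"
    using sb cb by (simp add: h field_simps)
  then show ?thesis
    using Re ImS unfolding vertex_base_edge[OF P j]
    by (simp add: complex_eq_iff h \<tau>_def b_def algebra_simps)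
qed

section \<open>The orbit and its period\<close>

text \<open>\<open>Complex 1 (tan x)\<close> is \<open>cis x\<close> divided by
  \<open>cos x\<close>; take \<open>x = - \<theta>\<close> and \<open>x = \<theta>\<close>, where
  the cosines agree.\<close>

lemma Complex_tan_mult_cis:
  assumes "cos \<theta> \<noteq> 0"
  shows "Complex 1 (- tan \<theta>) * cis (2 * \<theta>) = Complex 1 (tan \<theta>)"
proof -
  have *: "Complex 1 (tan x) = cis x / of_real (cos x)" if "cos x \<noteq> 0" for x
    using that by (simp add: complex_eq_iff tan_def Re_divide_of_real Im_divide_of_real)
  show ?thesis
    using *[of \<theta>] *[of "- \<theta>"] assms by (simp add: cis_mult)
qed

theorem lemma4p1:
  fixes N k :: nat and P S :: regpoly and d :: rotation
  assumes "3 \<le> N"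
    and "regular_gon N P" and "center P = 0" and "standard_orientation P"
    and "1 \<le> k" and "2 * k < N"
    and "is_tile P k S"
  shows "(\<exists>p c :: nat \<Rightarrow> complex.
            (\<forall>j. iterate (outer_billiards d (region P)) j (center S) = Some (p j)) \<and>
            (\<forall>j. support_vertex d (region P) (p j) (c j)) \<and>
            (\<exists>s \<in> {1, - 1 :: int}. \<forall>j. \<exists>i :: int.
                c j = vertex P i \<and> c (Suc j) = vertex P (i + s * int k))) \<and>
         has_period (outer_billiards d (region P)) (center S) (N div gcd k N)"
proof -
  note P = assms(2,3)
  define \<theta> where "\<theta> = real k * pi / real N"
  define t where "t = tan \<theta>"
  define s :: int where "s = (case d of Counterclockwise \<Rightarrow> 1 | Clockwise \<Rightarrow> - 1)"
  define T where "T = outer_billiards d (region P)"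
  have s: "s = 1 \<and> orientation d = 1 \<or> s = - 1 \<and> orientation d = - 1"
    by (cases d) (auto simp: s_def)
  have sides: "sides P = N" using P by (simp add: regular_gon_def)
  have "real (2 * k) < real N" using assms(6) by (simp only: of_nat_less_iff)
  then have \<theta>: "0 < \<theta>" "\<theta> < pi / 2"
    using assms(1,5) by (auto simp: \<theta>_def field_simps)
  then have cos: "cos \<theta> \<noteq> 0" using cos_gt_zero[of \<theta>] by simp
  have t: "0 < t" using \<theta> by (simp add: t_def tan_gt_zero)
  have vadd: "vertex P (i + int k) = vertex P i * cis (2 * \<theta>)" for i
    by (simp add: vertex_add[OF P(2)] sides \<theta>_def mult_ac)
  \<comment> \<open>The tangents at vertices \<open>i\<close> and \<open>i + int k\<close> meet in
    this point, which can therefore be written relative to either vertex.\<close>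
  have move: "vertex P (i + int k) * Complex 1 (- t) = vertex P i * Complex 1 t" for i
    using Complex_tan_mult_cis[OF cos] by (simp add: vadd t_def mult_ac)
  obtain j0 where j0: "is_base_edge P j0"
    using assms(4) by (auto simp: standard_orientation_def)
  \<comment> \<open>For \<open>s = - 1\<close> the tile center has to be written with the factor
    \<open>Complex 1 t\<close>; by \<open>move\<close> the vertex for this is
    \<open>j0 - int k\<close>.\<close>
  define i0 where "i0 = (if s = 1 then j0 else j0 - int k)"
  define v where "v j = i0 + s * (int k * int j)" for j
  define p where "p j = vertex P (v j) * Complex 1 (- orientation d * t)" for j
  have v_Suc: "v (Suc j) = v j + s * int k" for j by (simp add: v_def algebra_simps)
  have sv: "support_vertex d (region P) (p j) (vertex P (v j))" for j
    unfolding p_def using support_vertex_tangent[OF P t] .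
  have p0: "center S = p 0"
    using tile_center[OF P j0 assms(7)] s move[of i0]
    by (auto simp: p_def v_def i0_def t_def \<theta>_def)
  have step: "T (p j) = Some (p (Suc j))" for j
  proof -
    have "T (p j) = Some (2 * vertex P (v j) - p j)"
      unfolding T_def by (rule outer_billiards_eq[OF sv])
    also have "2 * vertex P (v j) - p j = vertex P (v j) * Complex 1 (orientation d * t)"
      by (simp add: p_def complex_eq_iff algebra_simps)
    also have "\<dots> = p (Suc j)"
      \<comment> \<open>The instance at \<open>v j\<close> serves \<open>s = 1\<close>, the one at
        \<open>v j - int k\<close> serves \<open>s = - 1\<close>.\<close>
      using s move[of "v j"] move[of "v j - int k"] by (auto simp: p_def v_Suc)
    finally show ?thesis .
  qed
  have iter: "iterate T j (center S) = Some (p j)" for j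
    by (induction j) (simp_all add: p0 step)
  \<comment> \<open>Describing all returns at once also excludes one before the claimed
    period.\<close>
  have period_iff: "p j = p 0 \<longleftrightarrow> N div gcd k N dvd j" for j
  proof -
    have "Complex 1 (- orientation d * t) \<noteq> 0" by (simp add: complex_eq_iff)
    then have "p j = p 0 \<longleftrightarrow> vertex P (v j) = vertex P i0" by (simp add: p_def v_def)
    also have "\<dots> \<longleftrightarrow> int N dvd s * (int k * int j)"
      unfolding v_def by (rule vertex_add_eq_iff[OF P])
    also have "\<dots> \<longleftrightarrow> int N dvd int (k * j)" using s by auto
    also have "\<dots> \<longleftrightarrow> N dvd k * j" by (simp only: int_dvd_int_iff)
    also have "\<dots> \<longleftrightarrow> N div gcd k N dvd j"
    proof -
      define g where "g = gcd k N"
      have g: "0 < g" using assms(1) by (simp add: g_def)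
      obtain a b where ab: "k = a * g" "N = b * g" "coprime a b"
        unfolding g_def using gcd_coprime_exists[of k N] assms(1) by auto
      have "N dvd k * j \<longleftrightarrow> b * g dvd a * j * g" by (simp add: ab mult_ac)
      also have "\<dots> \<longleftrightarrow> b dvd a * j" using g by simp
      also have "\<dots> \<longleftrightarrow> b dvd j" using ab(3) by (simp add: coprime_dvd_mult_right_iff coprime_commute)
      finally show ?thesis unfolding g_def[symmetric] using g by (simp add: ab(2))
    qed
    finally show ?thesis .
  qed
  have "0 < N div gcd k N"
    using assms(1) by (simp add: div_greater_zero_iff)
  then have "has_period T (center S) (N div gcd k N)"
    unfolding has_period_def iter option.inject
    by (auto simp: p0 period_iff dest: nat_dvd_not_less)
  moreover have "\<exists>s \<in> {1, - 1 :: int}. \<forall>j. \<exists>i :: int.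
      vertex P (v j) = vertex P i \<and> vertex P (v (Suc j)) = vertex P (i + s * int k)"
    using s v_Suc by (intro bexI[of _ s]) auto
  ultimately show ?thesis
    using iter sv unfolding T_def by (intro conjI exI[of _ p] exI[of _ "\<lambda>j. vertex P (v j)"]) auto
qed

end
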